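(* Let $Q\in\mathbb{F}_q[x]$ be an irreducible polynomial with $\deg Q\ge2$, let $\mathfrak{D}=\deg Q-1$, and let \[ X(Q)=\left\{\chi\neq\chi_0\ \mathrm{mod}\ Q \;:\; L\left(\tfrac12,\chi\right)\neq0\right\}. \] Then \[ |X(Q)|\gg\frac{q^{\mathfrak{D}}}{\mathfrak{D}} \qquad\text{and}\qquad \frac{|X(Q)|}{\left|\{\chi\neq\chi_0\ \mathrm{mod}\ Q\}\right|}\gg\frac{1}{\mathfrak{D}}, \] where the implied positive constants depend at most on $q$.
   Context: $\mathbb{F}_q$ is a fixed finite field with $q$ elements and $\mathcal{A}=\mathbb{F}_q[x]$. For nonzero $N\in\mathcal{A}$, $|N|=q^{\deg N}$. A Dirichlet character modulo $Q$ is a function $\chi:\mathcal{A}\to\mathbb{C}$ with $\chi(A+BQ)=\chi(A)$ and $\chi(AB)=\chi(A)\chi(B)$ for all $A,B\in\mathcal{A}$, and $\chi(A)\neq0$ if and only if $(A,Q)=1$; $\chi_0$ is the trivial character ($\chi_0(A)=1$ whenever $(A,Q)=1$). The L-function is $L(s,\chi)=\sum_{N\text{ monic}}\chi(N)|N|^{-s}$ for $\Re(s)>1$. For $\chi\neq\chi_0$ one has $\sum_{N\text{ monic},\,\deg N=n}\chi(N)=0$ for $n\ge\deg Q$, so $L(s,\chi)$ is a polynomial in $q^{-s}$, which gives its value for all $s$; in particular $L(\tfrac12,\chi)=\sum_{n=0}^{\deg Q-1}q^{-n/2}\sum_{N\text{ monic},\,\deg N=n}\chi(N)$. *)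

theory Defs
  imports
    "HOL-Analysis.Analysis"
    "HOL-Computational_Algebra.Polynomial"
begin

definition dirichlet_char :: "'a::{field,finite} poly \<Rightarrow> ('a poly \<Rightarrow> complex) \<Rightarrow> bool" where
  "dirichlet_char Q chi \<longleftrightarrow>
     (\<forall>A B. chi (A + B * Q) = chi A) \<and>
     (\<forall>A B. chi (A * B) = chi A * chi B) \<and>
     (\<forall>A. chi A \<noteq> 0 \<longleftrightarrow> coprime A Q)"

definition trivial_char :: "'a::{field,finite} poly \<Rightarrow> 'a poly \<Rightarrow> complex" where
  "trivial_char Q A = (if coprime A Q then 1 else 0)"

definition nontrivial_chars :: "'a::{field,finite} poly \<Rightarrow> ('a poly \<Rightarrow> complex) set" where
  "nontrivial_chars Q = {chi. dirichlet_char Q chi \<and> chi \<noteq> trivial_char Q}"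

definition monic_polys :: "'a::{field,finite} poly set" where
  "monic_polys = {N. lead_coeff N = 1}"

definition monic_polys_deg :: "nat \<Rightarrow> 'a::{field,finite} poly set" where
  "monic_polys_deg n = {N. lead_coeff N = 1 \<and> degree N = n}"

text \<open>
  The absolute value $|N| = q^{\deg N}$. It is only ever used for $N \neq 0$; at $N = 0$ the
  formula gives $1$.
\<close>
definition poly_abs :: "'a::{field,finite} poly \<Rightarrow> real" where
  "poly_abs N = real CARD('a) ^ degree N"

text \<open>
  For $\Re s > 1$ this is the absolutely convergent Dirichlet series. Elsewhere it is the
  polynomial in $q^{-s}$ that continues the series; this branch has its intended meaning only for
  nontrivial \<open>chi\<close>. For those, lemma \<open>dirichlet_L_eq_polynomial\<close> below shows
  that both branches are given by the same polynomial, so that the function is entire.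
\<close>
definition dirichlet_L ::
    "'a::{field,finite} poly \<Rightarrow> complex \<Rightarrow> ('a poly \<Rightarrow> complex) \<Rightarrow> complex" where
  "dirichlet_L Q s chi =
     (if Re s > 1
      then (\<Sum>\<^sub>\<infinity>N\<in>monic_polys. chi N * of_real (poly_abs N) powr (-s))
      else (\<Sum>n<degree Q. of_nat CARD('a) powr (- (of_nat n * s)) *
              (\<Sum>N\<in>monic_polys_deg n. chi N)))"

definition nonvanishing_chars :: "'a::{field,finite} poly \<Rightarrow> ('a poly \<Rightarrow> complex) set" where
  "nonvanishing_chars Q = {chi \<in> nontrivial_chars Q. dirichlet_L Q (1/2) chi \<noteq> 0}"


subsection \<open>Consistency of the definition of the L-function\<close>

lemma finite_degree_le: "finite {N :: 'a::{field,finite} poly. degree N \<le> n}"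
  and card_degree_le:
    "card {N :: 'a::{field,finite} poly. degree N \<le> n} \<le> CARD('a) ^ Suc n"
proof -
  let ?S = "{N :: 'a poly. degree N \<le> n}"
  let ?T = "{..n} \<rightarrow>\<^sub>E (UNIV :: 'a set)"
  let ?f = "\<lambda>N. restrict (coeff N) {..n}"
  have inj: "inj_on ?f ?S"
  proof (rule inj_onI)
    fix M N :: "'a poly"
    assume *: "M \<in> ?S" "N \<in> ?S" "?f M = ?f N"
    show "M = N"
    proof (rule poly_eqI)
      fix i
      show "coeff M i = coeff N i"
      proof (cases "i \<le> n")
        case True
        then show ?thesis using fun_cong[OF *(3), of i] by simp
      next
        case False
        then show ?thesis using * by (simp add: coeff_eq_0)
      qed
    qed
  qed
  have sub: "?f ` ?S \<subseteq> ?T" by (rule image_subsetI) (simp add: restrict_PiE_iff)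
  have fin: "finite ?T" by (intro finite_PiE) auto
  show "finite ?S" using inj sub fin by (meson finite_imageD finite_subset)
  have "card ?S \<le> card ?T" using inj sub fin by (rule card_inj_on_le)
  also have "card ?T = CARD('a) ^ Suc n" by (simp add: card_PiE)
  finally show "card ?S \<le> CARD('a) ^ Suc n" .
qed

lemma finite_monic_polys_deg: "finite (monic_polys_deg n :: 'a::{field,finite} poly set)"
  by (rule finite_subset[OF _ finite_degree_le[of n]]) (auto simp: monic_polys_deg_def)

lemma card_monic_polys_deg_le:
  "card (monic_polys_deg n :: 'a::{field,finite} poly set) \<le> CARD('a) ^ Suc n"
proof -
  have "card (monic_polys_deg n :: 'a poly set) \<le> card {N :: 'a poly. degree N \<le> n}"
    by (rule card_mono[OF finite_degree_le]) (auto simp: monic_polys_deg_def)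
  then show ?thesis using card_degree_le[of n, where 'a='a] by linarith
qed

lemma dirichlet_char_mod:
  assumes "dirichlet_char Q chi"
  shows "chi (A mod Q) = chi A"
proof -
  have "chi (A mod Q + (A div Q) * Q) = chi (A mod Q)"
    using assms unfolding dirichlet_char_def by blast
  then show ?thesis by (simp add: mod_div_mult_eq)
qed

lemma dirichlet_char_bounded:
  fixes Q :: "'a::{field,finite} poly"
  assumes "dirichlet_char Q chi" "Q \<noteq> 0"
  obtains C where "C > 0" "\<And>A. norm (chi A) \<le> C"
proof -
  have "range chi \<subseteq> chi ` {N. degree N \<le> degree Q}"
  proof
    fix z assume "z \<in> range chi"
    then obtain A where "z = chi A" by auto
    then have "z = chi (A mod Q)" using dirichlet_char_mod[OF assms(1)] by simp
    moreover have "degree (A mod Q) \<le> degree Q"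
      using degree_mod_less[OF assms(2), of A] by auto
    ultimately show "z \<in> chi ` {N. degree N \<le> degree Q}" by blast
  qed
  then have "finite (range chi)"
    using finite_degree_le[of "degree Q", where 'a='a] by (meson finite_imageI finite_subset)
  then have "bounded (range chi)" by (rule finite_imp_bounded)
  then show ?thesis using that unfolding bounded_pos by blast
qed

text \<open>
  The library proves this in gcd classes only, which do not cover \<^typ>\<open>'a poly\<close> for a
  type \<open>'a\<close> that is merely a field.
\<close>
lemma poly_coprime_dvd_mult:
  fixes B Q D :: "'a::field poly"
  assumes "coprime B Q" "Q dvd B * D"
  shows "Q dvd D"
proof -
  define P where "P = (\<lambda>d. d \<noteq> 0 \<and> (\<exists>u v. d = u * B + v * Q))"
  have "B \<noteq> 0 \<or> Q \<noteq> 0" using assms(1) by auto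
  then have "P B \<or> P Q"
    unfolding P_def by (metis add.left_neutral add.right_neutral mult_1 mult_zero_left)
  then obtain d where d: "P d" and least: "\<And>e. P e \<Longrightarrow> degree d \<le> degree e"
    using ex_has_least_nat[of P _ degree] by blast
  then obtain u v where d0: "d \<noteq> 0" and uv: "d = u * B + v * Q" by (auto simp: P_def)
  have dvd: "d dvd x * B + y * Q" for x y
  proof (rule ccontr)
    assume "\<not> d dvd x * B + y * Q"
    then have nz: "(x * B + y * Q) mod d \<noteq> 0" by (simp add: mod_eq_0_iff_dvd)
    define k where "k = (x * B + y * Q) div d"
    have "(x * B + y * Q) mod d = x * B + y * Q - k * d"
      by (simp add: k_def minus_div_mult_eq_mod)
    also have "\<dots> = (x - k * u) * B + (y - k * v) * Q"
      by (simp add: uv algebra_simps)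
    finally have "P ((x * B + y * Q) mod d)" using nz unfolding P_def by blast
    then show False using least degree_mod_less'[OF d0 nz] by fastforce
  qed
  have "is_unit d"
    using assms(1) dvd[of 1 0] dvd[of 0 1] by (simp add: coprime_def)
  moreover have "Q dvd d * D"
  proof -
    have "d * D = u * (B * D) + Q * (v * D)" by (simp add: uv algebra_simps)
    then show ?thesis using assms(2) by simp
  qed
  ultimately show ?thesis by (metis dvd_mult_unit_iff mult.commute)
qed

lemma nontrivial_char_sum_monic_eq_0:
  fixes Q :: "'a::{field,finite} poly"
  assumes chi: "chi \<in> nontrivial_chars Q" and Q: "Q \<noteq> 0" and n: "n \<ge> degree Q"
  shows "(\<Sum>N\<in>monic_polys_deg n. chi N) = 0"
proof -
  have char: "dirichlet_char Q chi" and "chi \<noteq> trivial_char Q"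
    using chi by (auto simp: nontrivial_chars_def)
  then obtain B where B': "chi B \<noteq> trivial_char Q B" by blast
  have B: "coprime B Q" "chi B \<noteq> 1"
    using B' char by (auto simp: trivial_char_def dirichlet_char_def split: if_splits)
  define g where "g = (\<lambda>N. N + (B * N - N) mod Q)"
  have g_mod: "g N mod Q = (B * N) mod Q" for N
    by (simp add: g_def mod_add_right_eq)
  have inj: "inj_on g (monic_polys_deg n)"
  proof (rule inj_onI)
    fix M N assume "M \<in> monic_polys_deg n" "N \<in> monic_polys_deg n" and eq: "g M = g N"
    have "(B * M) mod Q = (B * N) mod Q" using g_mod eq by metis
    then have "Q dvd B * M - B * N" by (simp add: mod_eq_dvd_iff)
    then have "Q dvd B * (M - N)" by (simp add: algebra_simps)
    then have "Q dvd M - N"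
      by (rule poly_coprime_dvd_mult[OF B(1)])
    then have "Q dvd (B * M - M) - (B * N - N)"
    proof -
      have "(B * M - M) - (B * N - N) = (B - 1) * (M - N)" by (simp add: algebra_simps)
      then show ?thesis using \<open>Q dvd M - N\<close> by simp
    qed
    then have "(B * M - M) mod Q = (B * N - N) mod Q" by (simp add: mod_eq_dvd_iff)
    then show "M = N" using eq by (simp add: g_def)
  qed
  have into: "g N \<in> monic_polys_deg n" if N: "N \<in> monic_polys_deg n" for N
  proof (cases "(B * N - N) mod Q = 0")
    case True
    then show ?thesis using N by (simp add: g_def)
  next
    case False
    then have less: "degree ((B * N - N) mod Q) < degree N"
      using degree_mod_less'[OF Q False] N n by (simp add: monic_polys_deg_def)
    then have "degree (g N) = degree N" by (simp add: g_def degree_add_eq_left)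
    moreover have "coeff (g N) (degree N) = lead_coeff N"
      using less by (simp add: g_def coeff_eq_0)
    ultimately show ?thesis using N by (auto simp: monic_polys_deg_def)
  qed
  have bij: "bij_betw g (monic_polys_deg n) (monic_polys_deg n)"
    using inj into finite_monic_polys_deg
    by (metis bij_betw_def endo_inj_surj image_subsetI)
  have "chi (g N) = chi B * chi N" for N
  proof -
    have "chi (g N) = chi (B * N)"
      using dirichlet_char_mod[OF char] g_mod by metis
    then show ?thesis using char by (simp add: dirichlet_char_def)
  qed
  then have "(\<Sum>N\<in>monic_polys_deg n. chi N) = chi B * (\<Sum>N\<in>monic_polys_deg n. chi N)"
    using sum.reindex_bij_betw[OF bij, of chi] by (simp add: sum_distrib_left)
  then show ?thesis using B(2) by simp
qed

lemma poly_abs_powr: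
  fixes N :: "'a::{field,finite} poly"
  assumes "degree N = n"
  shows "complex_of_real (poly_abs N) powr (-s) = of_nat CARD('a) powr (- (of_nat n * s))"
proof -
  have pos: "real CARD('a) > 0" by simp
  have "Ln (complex_of_real (real CARD('a) ^ n)) = of_real (ln (real CARD('a) ^ n))"
    by (rule Ln_of_real) simp
  also have "\<dots> = of_nat n * of_real (ln (real CARD('a)))"
    by (simp add: ln_realpow)
  also have "of_real (ln (real CARD('a))) = Ln (complex_of_real (real CARD('a)))"
    by (rule Ln_of_real[OF pos, symmetric])
  finally have "Ln (complex_of_real (real CARD('a) ^ n)) = of_nat n * Ln (of_nat CARD('a))"
    by (simp only: of_real_of_nat_eq)
  then show ?thesis using assms by (simp add: poly_abs_def powr_def algebra_simps)
qed

lemma dirichlet_L_abs_summable: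
  fixes Q :: "'a::{field,finite} poly"
  assumes char: "dirichlet_char Q chi" and Q: "Q \<noteq> 0" and s: "Re s > 1"
  shows "(\<lambda>x. norm (case x of (n, N) \<Rightarrow> chi N * of_real (poly_abs N) powr (-s)))
           summable_on (SIGMA n:UNIV. monic_polys_deg n)"
proof -
  obtain C where C: "C > 0" "\<And>A. norm (chi A) \<le> C"
    using dirichlet_char_bounded[OF char Q] by blast
  define q where "q = real CARD('a)"
  have "card {0, 1 :: 'a} \<le> CARD('a)" by (rule card_mono) auto
  then have q: "q > 1" by (simp add: q_def)
  define r where "r = q powr (1 - Re s)"
  have r: "0 \<le> r" "r < 1"
    using q s by (auto simp: r_def powr_less_one)
  have norm_powr: "norm (of_real (poly_abs N) powr (-s)) = q powr (- (real n * Re s))"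
    if "N \<in> monic_polys_deg n" for n and N :: "'a poly"
  proof -
    have "complex_of_real (poly_abs N) powr (-s) = of_real q powr (- (of_nat n * s))"
      using that poly_abs_powr[of N n s] by (simp add: monic_polys_deg_def q_def)
    then show ?thesis using q by (simp add: norm_powr_real_powr)
  qed
  have bound: "(\<Sum>N\<in>monic_polys_deg n. norm (chi N * of_real (poly_abs N) powr (-s)))
                 \<le> C * q * r ^ n" for n
  proof -
    have "(\<Sum>N\<in>monic_polys_deg n. norm (chi N * of_real (poly_abs N) powr (-s)))
            \<le> of_nat (card (monic_polys_deg n :: 'a poly set)) * (C * q powr (- (real n * Re s)))"
      by (rule sum_bounded_above) (auto simp: norm_mult norm_powr intro!: mult_right_mono C)
    also have "\<dots> \<le> q ^ Suc n * (C * q powr (- (real n * Re s)))"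
    proof (rule mult_right_mono)
      have "real (card (monic_polys_deg n :: 'a poly set)) \<le> real (CARD('a) ^ Suc n)"
        using card_monic_polys_deg_le by (rule of_nat_mono)
      then show "real (card (monic_polys_deg n :: 'a poly set)) \<le> q ^ Suc n"
        by (simp add: q_def)
    qed (use C in auto)
    also have "q ^ Suc n * (C * q powr (- (real n * Re s))) = C * q * r ^ n"
    proof -
      have "q ^ n * q powr (- (real n * Re s)) = r ^ n"
      proof -
        have "q ^ n = q powr real n" using q by (simp add: powr_realpow)
        moreover have "r ^ n = q powr (real n * (1 - Re s))"
          using q by (simp add: r_def powr_powr mult.commute flip: powr_realpow)
        ultimately show ?thesis by (simp add: algebra_simps flip: powr_add)
      qed
      then show ?thesis by (simp add: algebra_simps)
    qed
    finally show ?thesis .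
  qed
  have "summable (\<lambda>n. C * q * r ^ n)"
    using r by (intro summable_mult summable_geometric) simp
  then have "summable (\<lambda>n. norm (\<Sum>N\<in>monic_polys_deg n.
                norm (chi N * of_real (poly_abs N) powr (-s))))"
    by (rule summable_comparison_test'[of _ 0]) (use bound in \<open>simp add: sum_nonneg\<close>)
  then have "(\<lambda>n. norm (\<Sum>N\<in>monic_polys_deg n.
                norm (chi N * of_real (poly_abs N) powr (-s)))) summable_on UNIV"
    by (intro norm_summable_imp_summable_on) simp
  then show ?thesis
    by (subst Infinite_Sum.abs_summable_on_Sigma_iff) (simp add: finite_monic_polys_deg)
qed

lemma dirichlet_L_eq_polynomial:
  fixes Q :: "'a::{field,finite} poly"
  assumes chi: "chi \<in> nontrivial_chars Q" and Q: "Q \<noteq> 0"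
  shows "dirichlet_L Q s chi =
           (\<Sum>n<degree Q. of_nat CARD('a) powr (- (of_nat n * s)) *
              (\<Sum>N\<in>monic_polys_deg n. chi N))"
proof (cases "Re s > 1")
  case False
  then show ?thesis by (simp add: dirichlet_L_def)
next
  case True
  have char: "dirichlet_char Q chi" using chi by (simp add: nontrivial_chars_def)
  let ?f = "\<lambda>N. chi N * of_real (poly_abs N) powr (-s)"
  let ?S = "SIGMA n:UNIV. (monic_polys_deg n :: 'a poly set)"
  have bij: "bij_betw snd ?S monic_polys"
    by (rule bij_betw_byWitness[of _ "\<lambda>N. (degree N, N)"])
       (auto simp: monic_polys_deg_def monic_polys_def)
  have summ: "(\<lambda>(n, N). ?f N) summable_on ?S"
    by (rule Infinite_Sum.abs_summable_summable[OF dirichlet_L_abs_summable[OF char Q True]])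
  have "dirichlet_L Q s chi = (\<Sum>\<^sub>\<infinity>N\<in>monic_polys. ?f N)"
    using True by (simp add: dirichlet_L_def)
  also have "\<dots> = (\<Sum>\<^sub>\<infinity>(n, N)\<in>?S. ?f N)"
    using infsum_reindex_bij_betw[OF bij, of ?f] by (simp add: case_prod_unfold)
  also have "\<dots> = (\<Sum>\<^sub>\<infinity>n\<in>UNIV. \<Sum>\<^sub>\<infinity>N\<in>monic_polys_deg n. ?f N)"
    by (rule infsum_Sigma'_banach[OF summ, symmetric])
  also have "\<dots> = (\<Sum>\<^sub>\<infinity>n\<in>UNIV. of_nat CARD('a) powr (- (of_nat n * s)) *
                       (\<Sum>N\<in>monic_polys_deg n. chi N))"
  proof (rule infsum_cong)
    fix n
    have "(\<Sum>\<^sub>\<infinity>N\<in>monic_polys_deg n. ?f N) = (\<Sum>N\<in>monic_polys_deg n. ?f N)"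
      by (simp add: finite_monic_polys_deg)
    also have "\<dots> = (\<Sum>N\<in>monic_polys_deg n. of_nat CARD('a) powr (- (of_nat n * s)) * chi N)"
      by (rule sum.cong) (auto simp: monic_polys_deg_def poly_abs_powr mult.commute)
    finally show "(\<Sum>\<^sub>\<infinity>N\<in>monic_polys_deg n. ?f N) =
        of_nat CARD('a) powr (- (of_nat n * s)) * (\<Sum>N\<in>monic_polys_deg n. chi N)"
      by (simp add: sum_distrib_left)
  qed
  also have "\<dots> = (\<Sum>\<^sub>\<infinity>n\<in>{..<degree Q}. of_nat CARD('a) powr (- (of_nat n * s)) *
                       (\<Sum>N\<in>monic_polys_deg n. chi N))"
    by (rule infsum_cong_neutral) (auto simp: nontrivial_char_sum_monic_eq_0[OF chi Q])
  also have "\<dots> = (\<Sum>n<degree Q. of_nat CARD('a) powr (- (of_nat n * s)) *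
                       (\<Sum>N\<in>monic_polys_deg n. chi N))"
    by simp
  finally show ?thesis .
qed

end

theory Submission
  imports "HOL-Algebra.Multiplicative_Group" Defs
begin

text \<open>
  By the Cauchy--Schwarz inequality, the number of nonvanishing central values is at least
  $|\sum_\chi L(1/2,\chi)|^2 / \sum_\chi |L(1/2,\chi)|^2$. Every $L(1/2,\chi)$ is a sum over monic
  polynomials of degree below $\deg Q$; these are pairwise incongruent modulo $Q$, so by
  orthogonality the sum of $|L(1/2,\chi)|^2$ over all characters is exactly
  $(q^{\deg Q}-1) \deg Q$, while the sum of $L(1/2,\chi)$ over all characters is exactly
  $q^{\deg Q}-1$, of which the trivial character contributes only
  $(q^{\deg Q/2}-1)/(q^{1/2}-1)$. The characters are enumerated by the complex roots of unity of
  order dividing $q^{\deg Q}-1$, as the values at a primitive root modulo $Q$.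
\<close>

section \<open>Polynomials modulo an irreducible polynomial\<close>

text \<open>The induction splits off the constant coefficient with \<open>pCons\<close>, giving a
  factor q at each step. Vanishing of all coefficients from n on is used in place of a degree bound
  because the zero polynomial has degree 0; in this form n = 0 describes exactly {0}.\<close>

lemma card_coeff_bounded:
  "finite {A :: 'a::{field,finite} poly. \<forall>i\<ge>n. poly.coeff A i = 0} \<and>
   card {A :: 'a::{field,finite} poly. \<forall>i\<ge>n. poly.coeff A i = 0} = CARD('a) ^ n"
proof (induction n)
  case 0
  have "{A :: 'a poly. \<forall>i\<ge>0. poly.coeff A i = 0} = {0}"
    by (auto simp: poly_eq_iff)
  then show ?case by simp
next
  case (Suc n)
  let ?S = "\<lambda>n. {A :: 'a poly. \<forall>i\<ge>n. poly.coeff A i = 0}"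
  have "(\<forall>i\<ge>Suc n. poly.coeff (pCons a B) i = 0) \<longleftrightarrow> (\<forall>i\<ge>n. poly.coeff B i = 0)"
    for a and B :: "'a poly"
    by (auto simp: coeff_pCons Suc_le_eq split: nat.splits)
  then have pCons: "pCons a B \<in> ?S (Suc n) \<longleftrightarrow> B \<in> ?S n" for a B
    by simp
  have "?S (Suc n) = case_prod pCons ` (UNIV \<times> ?S n)"
  proof (intro Set.set_eqI iffI)
    fix A assume A: "A \<in> ?S (Suc n)"
    obtain a B where "A = pCons a B" by (cases A)
    with A pCons have "A = case_prod pCons (a, B)" "(a, B) \<in> UNIV \<times> ?S n" by simp_all
    then show "A \<in> case_prod pCons ` (UNIV \<times> ?S n)" by (rule image_eqI)
  qed (use pCons in auto)
  moreover have "inj_on (case_prod pCons) (UNIV \<times> ?S n)"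
    by (auto simp: inj_on_def)
  ultimately show ?case using Suc by (simp add: card_image card_cartesian_product)
qed

text \<open>Identifies the reduced remainders modulo Q with the set counted in
  \<open>card_coeff_bounded\<close>, so that there are q^deg Q residue classes.\<close>

lemma mod_eq_self_poly_iff:
  fixes A Q :: "'a::field poly"
  assumes "Q \<noteq> 0"
  shows "A mod Q = A \<longleftrightarrow> (\<forall>i\<ge>degree Q. poly.coeff A i = 0)"
proof
  assume "A mod Q = A"
  then have "A = 0 \<or> degree A < degree Q" using degree_mod_less[OF assms, of A] by auto
  then show "\<forall>i\<ge>degree Q. poly.coeff A i = 0" by (auto simp: coeff_eq_0)
next
  assume *: "\<forall>i\<ge>degree Q. poly.coeff A i = 0"
  show "A mod Q = A"
  proof (cases "A = 0")
    case False
    then have "degree A < degree Q" using * by (metis leading_coeff_0_iff not_le)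
    then show ?thesis by (rule mod_poly_less)
  qed simp
qed

text \<open>Removing the leading monomial x^n leaves n free coefficients.\<close>

lemma card_monic_polys_deg:
  "card (monic_polys_deg n :: 'a::{field,finite} poly set) = CARD('a) ^ n"
proof -
  let ?S = "{A :: 'a poly. \<forall>i\<ge>n. poly.coeff A i = 0}"
  have "bij_betw (\<lambda>A. A + Polynomial.monom 1 n) ?S (monic_polys_deg n)"
  proof (rule bij_betw_byWitness[of _ "\<lambda>A. A - Polynomial.monom 1 n"])
    show "(\<lambda>A. A + Polynomial.monom 1 n) ` ?S \<subseteq> monic_polys_deg n"
    proof
      fix N assume "N \<in> (\<lambda>A. A + Polynomial.monom 1 n) ` ?S"
      then obtain A where A: "\<forall>i\<ge>n. poly.coeff A i = 0" and N: "N = A + Polynomial.monom 1 n"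
        by auto
      have "poly.coeff N n = 1" using A N by simp
      moreover have "poly.coeff N i = 0" if "i > n" for i using A N that by simp
      ultimately have "degree N = n" by (intro antisym degree_le le_degree) auto
      then show "N \<in> monic_polys_deg n"
        using \<open>poly.coeff N n = 1\<close> by (simp add: monic_polys_deg_def)
    qed
    show "(\<lambda>A. A - Polynomial.monom 1 n) ` monic_polys_deg n \<subseteq> ?S"
      by (auto simp: monic_polys_deg_def coeff_eq_0)
  qed auto
  from bij_betw_same_card[OF this] show ?thesis
    using card_coeff_bounded[of n, where 'a='a] by simp
qed

section \<open>The residue field modulo an irreducible polynomial and its primitive roots\<close>

lemma irreducible_coprime_iff:
  fixes Q :: "'a::field poly"
  assumes "irreducible Q"
  shows "coprime A Q \<longleftrightarrow> \<not> Q dvd A"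
proof
  assume "coprime A Q"
  then show "\<not> Q dvd A" using assms by (meson coprime_common_divisor dvd_refl irreducible_not_unit)
next
  assume *: "\<not> Q dvd A"
  show "coprime A Q"
  proof (rule coprimeI)
    fix d assume "d dvd A" "d dvd Q"
    from \<open>d dvd Q\<close> obtain e where e: "Q = d * e" ..
    have "\<not> is_unit e"
    proof
      assume "is_unit e"
      then have "Q dvd d" using e by (simp add: mult_unit_dvd_iff)
      then show False using * \<open>d dvd A\<close> dvd_trans by blast
    qed
    then show "is_unit d" using irreducibleD[OF assms e] by blast
  qed
qed

text \<open>The quotient ring is modelled on reduced representatives as a HOL-Algebra record, so
  that the cyclicity of the unit group of a finite field can be applied. The unit is
  \<open>1 mod Q\<close> rather than 1, which keeps the ring laws valid when Q is a unit and the
  quotient is zero.\<close>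

definition residue_ring_poly :: "'a::field poly \<Rightarrow> 'a poly ring" where
  "residue_ring_poly Q = \<lparr>carrier = {A. A mod Q = A}, monoid.mult = (\<lambda>A B. A * B mod Q), one = 1 mod Q,
     zero = 0, add = (\<lambda>A B. (A + B) mod Q)\<rparr>"

lemma residue_ring_poly_simps [simp]:
  "carrier (residue_ring_poly Q) = {A. A mod Q = A}"
  "A \<otimes>\<^bsub>residue_ring_poly Q\<^esub> B = A * B mod Q"
  "\<one>\<^bsub>residue_ring_poly Q\<^esub> = 1 mod Q"
  "\<zero>\<^bsub>residue_ring_poly Q\<^esub> = 0"
  "A \<oplus>\<^bsub>residue_ring_poly Q\<^esub> B = (A + B) mod Q"
  by (simp_all add: residue_ring_poly_def)

lemma residue_ring_poly_pow:
  "A [^]\<^bsub>residue_ring_poly Q\<^esub> (n::nat) = A ^ n mod Q"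
  by (induction n) (simp_all add: nat_pow_def mod_mult_left_eq mult.commute mod_mult_right_eq)

lemma cring_residue_ring_poly: "cring (residue_ring_poly (Q :: 'a::field poly))"
proof (rule cringI)
  show "abelian_group (residue_ring_poly Q)"
  proof (rule abelian_groupI)
    fix A assume A: "A \<in> carrier (residue_ring_poly Q)"
    have "((- A) mod Q + A) mod Q = 0" by (simp add: mod_add_left_eq)
    then show "\<exists>B\<in>carrier (residue_ring_poly Q). B \<oplus>\<^bsub>residue_ring_poly Q\<^esub> A = \<zero>\<^bsub>residue_ring_poly Q\<^esub>"
      by (intro bexI[of _ "(- A) mod Q"]) auto
  qed (auto simp: mod_add_left_eq mod_add_right_eq algebra_simps)
  show "comm_monoid (residue_ring_poly Q)"
    by (rule comm_monoidI) (auto simp: mod_mult_left_eq mod_mult_right_eq algebra_simps)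
qed (auto simp: mod_mult_left_eq mod_mult_right_eq mod_add_left_eq mod_add_right_eq algebra_simps)

text \<open>Multiplication by A is injective on the finite set of remainders, since Q is coprime to
  A. It is therefore surjective and attains \<open>1 mod Q\<close>.\<close>

lemma irreducible_inverse_mod:
  fixes Q :: "'a::{field,finite} poly"
  assumes Q: "irreducible Q" and A: "\<not> Q dvd A"
  obtains B where "B * A mod Q = 1 mod Q"
proof -
  have Q0: "Q \<noteq> 0" using Q by auto
  let ?R = "{A. A mod Q = A}"
  have fin: "finite ?R"
    using card_coeff_bounded[of "degree Q", where 'a='a] by (simp add: mod_eq_self_poly_iff[OF Q0])
  let ?f = "\<lambda>B. A * B mod Q"
  have "inj_on ?f ?R"
  proof (rule inj_onI)
    fix B C assume *: "B \<in> ?R" "C \<in> ?R" "A * B mod Q = A * C mod Q"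
    then have "Q dvd A * (B - C)" by (simp add: mod_eq_dvd_iff algebra_simps)
    then have "Q dvd B - C"
      using poly_coprime_dvd_mult irreducible_coprime_iff[OF Q] A by blast
    then have "B mod Q = C mod Q" by (simp add: mod_eq_dvd_iff)
    then show "B = C" using * by simp
  qed
  then have "?f ` ?R = ?R" by (intro endo_inj_surj fin) auto
  moreover have "1 mod Q \<in> ?R" by simp
  ultimately have "1 mod Q \<in> ?f ` ?R" by blast
  then obtain B where "A * B mod Q = 1 mod Q" by auto
  then show ?thesis using that[of B] by (simp add: mult.commute)
qed

lemma field_residue_ring_poly:
  fixes Q :: "'a::{field,finite} poly"
  assumes Q: "irreducible Q"
  shows "Ring.field (residue_ring_poly Q)"
proof -
  interpret cring "residue_ring_poly Q" by (rule cring_residue_ring_poly)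
  have one: "1 mod Q \<noteq> 0"
    using Q by (simp add: mod_eq_0_iff_dvd irreducible_not_unit)
  show ?thesis
  proof (rule cring_fieldI, intro Set.set_eqI iffI)
    fix A assume A: "A \<in> Units (residue_ring_poly Q)"
    then have "A \<noteq> 0" using one by (auto simp: Units_def)
    then show "A \<in> carrier (residue_ring_poly Q) - {\<zero>\<^bsub>residue_ring_poly Q\<^esub>}"
      using A by (auto simp: Units_def)
  next
    fix A assume A: "A \<in> carrier (residue_ring_poly Q) - {\<zero>\<^bsub>residue_ring_poly Q\<^esub>}"
    then have "\<not> Q dvd A" by (auto simp: dvd_eq_mod_eq_0)
    then obtain B where "B * A mod Q = 1 mod Q" by (rule irreducible_inverse_mod[OF Q])
    then show "A \<in> Units (residue_ring_poly Q)"
      using A by (auto simp: Units_def mult.commute mod_mult_left_eq mod_mult_right_eq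
          intro!: exI[of _ "B mod Q"])
  qed
qed

text \<open>Translates a generator of the cyclic unit group into congruences modulo Q, so that the
  characters can be handled without reference to the ring record.\<close>

lemma exists_primitive_root_poly:
  fixes Q :: "'a::{field,finite} poly"
  assumes Q: "irreducible Q"
  obtains g where "\<not> Q dvd g"
    and "\<And>A. \<not> Q dvd A \<Longrightarrow> \<exists>i. g ^ i mod Q = A mod Q"
    and "\<And>i. g ^ i mod Q = 1 mod Q \<longleftrightarrow> CARD('a) ^ degree Q - 1 dvd i"
proof -
  let ?R = "residue_ring_poly Q"
  interpret R: Ring.field ?R by (rule field_residue_ring_poly[OF Q])
  interpret G: group "mult_of ?R" by (rule R.field_mult_group)
  have Q0: "Q \<noteq> 0" using Q by auto
  have fin: "finite (carrier ?R)" and card: "card (carrier ?R) = CARD('a) ^ degree Q"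
    using card_coeff_bounded[of "degree Q", where 'a='a] by (auto simp: mod_eq_self_poly_iff[OF Q0])
  have finG: "finite (carrier (mult_of ?R))" using R.finite_mult_of[OF fin] .
  obtain g where g: "g \<in> carrier (mult_of ?R)"
    and gen: "carrier (mult_of ?R) = {g [^]\<^bsub>?R\<^esub> i | i::nat. i \<in> UNIV}"
    using R.finite_field_mult_group_has_gen[OF fin] by blast
  have pow: "g [^]\<^bsub>mult_of ?R\<^esub> i = g ^ i mod Q" for i :: nat
    by (simp add: nat_pow_mult_of residue_ring_poly_pow)
  \<comment> \<open>The order of g is found by counting: its powers with exponents below the order
    are distinct and exhaust the group.\<close>
  have "carrier (mult_of ?R) = {g [^]\<^bsub>mult_of ?R\<^esub> i | i. i \<in> {0 .. G.ord g - 1}}"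
    using gen G.ord_elems[OF finG g] by (simp add: nat_pow_mult_of)
  also have "\<dots> = (\<lambda>i. g [^]\<^bsub>mult_of ?R\<^esub> i) ` {0 .. G.ord g - 1}" by auto
  finally have "card (carrier (mult_of ?R)) = card {0 .. G.ord g - 1}"
    using G.ord_inj[OF g] by (simp add: card_image)
  then have "G.ord g = card (carrier (mult_of ?R))"
    using G.ord_ge_1[OF finG g] by simp
  also have "\<dots> = CARD('a) ^ degree Q - 1"
    using card fin by simp
  finally have ord: "G.ord g = CARD('a) ^ degree Q - 1" .
  show ?thesis
  proof (rule that[of g])
    show "\<not> Q dvd g" using g by (auto simp: dvd_eq_mod_eq_0)
    show "\<exists>i. g ^ i mod Q = A mod Q" if "\<not> Q dvd A" for A
    proof -
      have "A mod Q \<in> carrier (mult_of ?R)" using that by (simp add: dvd_eq_mod_eq_0)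
      then obtain i :: nat where "A mod Q = g [^]\<^bsub>?R\<^esub> i" unfolding gen by blast
      then show ?thesis by (metis residue_ring_poly_pow)
    qed
    show "g ^ i mod Q = 1 mod Q \<longleftrightarrow> CARD('a) ^ degree Q - 1 dvd i" for i
      using G.pow_eq_id[OF g, of i] ord by (simp add: pow)
  qed
qed

section \<open>Dirichlet characters and their orthogonality\<close>

lemma root_unity_power_cong:
  fixes z :: "'a::monoid_mult"
  assumes "z ^ n = 1" "i mod n = j mod n"
  shows "z ^ i = z ^ j"
proof -
  have "z ^ k = z ^ (k mod n)" for k
  proof -
    have "z ^ k = z ^ (n * (k div n) + k mod n)" by simp
    also have "\<dots> = z ^ (k mod n)" using assms(1) by (simp only: power_add power_mult) simp
    finally show ?thesis .
  qed
  then show ?thesis using assms(2) by metis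
qed

text \<open>If a and b are congruent modulo n, every term is a power of z * cnj z = 1. Otherwise
  rotation by a primitive n-th root w permutes the roots and multiplies the sum by w^a * cnj w^b,
  which differs from 1, so the sum is 0.\<close>

lemma roots_unity_orthogonality:
  assumes n: "n > 0"
  shows "(\<Sum>z | z ^ n = (1::complex). z ^ a * cnj z ^ b) =
           (if a mod n = b mod n then of_nat n else 0)"
proof -
  let ?U = "{z::complex. z ^ n = 1}"
  have norm: "norm z = 1" if "z \<in> ?U" for z
  proof -
    have "norm z ^ n = 1 ^ n" using that by (simp flip: norm_power)
    then show ?thesis using n by (intro power_eq_imp_eq_base[of "norm z" n 1]) auto
  qed
  have conj: "z * cnj z = 1" if "z \<in> ?U" for z
    using norm[OF that] by (simp add: complex_norm_square[symmetric])
  have pow_cong: "z ^ i = z ^ j" if "z \<in> ?U" "i mod n = j mod n" for z i j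
    using root_unity_power_cong that by blast
  show ?thesis
  proof (cases "a mod n = b mod n")
    case True
    have "(\<Sum>z\<in>?U. z ^ a * cnj z ^ b) = (\<Sum>z\<in>?U. 1)"
    proof (rule sum.cong[OF refl])
      fix z assume z: "z \<in> ?U"
      have "z ^ a * cnj z ^ b = (z * cnj z) ^ b"
        using pow_cong[OF z True] by (simp add: power_mult_distrib)
      then show "z ^ a * cnj z ^ b = 1" using conj[OF z] by simp
    qed
    then show ?thesis using True card_roots_unity_eq[OF n] by simp
  next
    case False
    define w where "w = cis (2 * pi / real n)"
    have bij: "bij_betw (\<lambda>k. cis (2 * pi * real k / real n)) {..<n} ?U"
      by (rule Complex.bij_betw_roots_unity[OF n])
    have w_pow: "w ^ k = cis (2 * pi * real k / real n)" for k
      unfolding w_def Complex.DeMoivre by (simp add: mult_ac)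
    have w: "w \<in> ?U" using n w_pow[of n] by simp
    have w0: "w \<noteq> 0" by (simp add: w_def)
    have ne: "w ^ a * cnj w ^ b \<noteq> 1"
    proof
      assume 1: "w ^ a * cnj w ^ b = 1"
      have "w ^ a = w ^ a * (w * cnj w) ^ b" using conj[OF w] by simp
      also have "\<dots> = (w ^ a * cnj w ^ b) * w ^ b"
        by (simp add: power_mult_distrib mult_ac)
      finally have "w ^ a = w ^ b" using 1 by simp
      \<comment> \<open>The powers of w are known to be distinct only for exponents below n, hence
        the reduction of both exponents.\<close>
      then have "w ^ (a mod n) = w ^ (b mod n)"
        using pow_cong[OF w, of "a mod n" a] pow_cong[OF w, of "b mod n" b] by simp
      then have "a mod n = b mod n"
        using n bij unfolding w_pow bij_betw_def
        by (metis (mono_tags, lifting) inj_onD lessThan_iff mod_less_divisor)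
      then show False using False by simp
    qed
    have "bij_betw (\<lambda>z. w * z) ?U ?U"
      by (rule bij_betw_byWitness[of _ "\<lambda>z. z / w"])
         (use w w0 in \<open>auto simp: power_mult_distrib power_divide\<close>)
    then have "(\<Sum>z\<in>?U. z ^ a * cnj z ^ b) = (\<Sum>z\<in>?U. (w * z) ^ a * cnj (w * z) ^ b)"
      by (rule sum.reindex_bij_betw[symmetric])
    also have "\<dots> = (w ^ a * cnj w ^ b) * (\<Sum>z\<in>?U. z ^ a * cnj z ^ b)"
      by (simp add: sum_distrib_left power_mult_distrib mult_ac)
    finally show ?thesis using ne False by (simp add: mult_cancel_right2)
  qed
qed

section \<open>Characters attached to roots of unity through a fixed primitive root\<close>

locale primitive_root_poly =
  fixes Q g :: "'a::{field,finite} poly"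
  assumes irreducible: "irreducible Q"
    and not_dvd_root: "\<not> Q dvd g"
    and root_power_exists: "\<And>A. \<not> Q dvd A \<Longrightarrow> \<exists>i. g ^ i mod Q = A mod Q"
    and root_power_eq_1_iff: "\<And>i. g ^ i mod Q = 1 mod Q \<longleftrightarrow> CARD('a) ^ degree Q - 1 dvd i"
begin

definition order_units :: nat where
  "order_units = CARD('a) ^ degree Q - 1"

text \<open>For A prime to Q the chosen exponent is determined only modulo
  \<open>order_units\<close>. For multiples of Q no exponent exists and the value is unspecified,
  which is why \<open>root_char\<close> treats them separately.\<close>

definition dlog :: "'a poly \<Rightarrow> nat" where
  "dlog A = (SOME i. g ^ i mod Q = A mod Q)"

definition root_char :: "complex \<Rightarrow> 'a poly \<Rightarrow> complex" where
  "root_char z A = (if Q dvd A then 0 else z ^ dlog A)"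

lemma card_field_ge_2: "CARD('a) \<ge> 2"
proof -
  have "card {0, 1 :: 'a} \<le> CARD('a)" by (rule card_mono) auto
  then show ?thesis by simp
qed

lemma Q_nonzero: "Q \<noteq> 0" using irreducible by auto

lemma degree_pos: "degree Q > 0"
  using irreducible Q_nonzero by (metis gr0I irreducible_not_unit is_unit_iff_degree)

lemma order_units_pos: "order_units > 0"
proof -
  have "1 < CARD('a) ^ degree Q"
    using card_field_ge_2 degree_pos by (intro one_less_power) auto
  then show ?thesis by (simp add: order_units_def)
qed

lemma prime_dvd_iff: "Q dvd A * B \<longleftrightarrow> Q dvd A \<or> Q dvd B"
  using poly_coprime_dvd_mult[of A Q B] irreducible_coprime_iff[OF irreducible, of A] by auto

lemma not_dvd_root_power: "\<not> Q dvd g ^ i"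
  by (induction i) (use not_dvd_root irreducible in \<open>auto simp: prime_dvd_iff irreducible_not_unit\<close>)

lemma dlog: "\<not> Q dvd A \<Longrightarrow> g ^ dlog A mod Q = A mod Q"
  unfolding dlog_def by (rule someI_ex) (rule root_power_exists)

text \<open>For i \<le> j the difference factors as g^i * (g^(j-i) - 1), and Q, being prime and not
  dividing g, must divide the second factor.\<close>

lemma root_power_eq_iff: "g ^ i mod Q = g ^ j mod Q \<longleftrightarrow> i mod order_units = j mod order_units"
proof (induction i j rule: linorder_wlog)
  case (le i j)
  have "g ^ i mod Q = g ^ j mod Q \<longleftrightarrow> Q dvd g ^ j - g ^ i"
    by (metis mod_eq_dvd_iff)
  also have "g ^ j - g ^ i = g ^ i * (g ^ (j - i) - 1)"
    using le by (simp add: algebra_simps flip: power_add)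
  also have "Q dvd \<dots> \<longleftrightarrow> g ^ (j - i) mod Q = 1 mod Q"
    by (simp add: prime_dvd_iff not_dvd_root_power mod_eq_dvd_iff)
  also have "\<dots> \<longleftrightarrow> j mod order_units = i mod order_units"
    using le by (simp add: root_power_eq_1_iff order_units_def mod_eq_dvd_iff_nat)
  finally show ?case by auto
qed auto

text \<open>The arbitrary choice in \<open>dlog\<close> is harmless once z is a root of unity of
  order dividing \<open>order_units\<close>: any exponent representing A gives the same
  value.\<close>

lemma root_char_eq_power:
  assumes z: "z ^ order_units = 1" and A: "A mod Q = g ^ i mod Q"
  shows "root_char z A = z ^ i"
proof -
  have nd: "\<not> Q dvd A"
    using A not_dvd_root_power[of i] by (simp add: dvd_eq_mod_eq_0)
  then have "g ^ dlog A mod Q = g ^ i mod Q" using dlog A by simp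
  then have "z ^ dlog A = z ^ i" using root_unity_power_cong[OF z] root_power_eq_iff by blast
  then show ?thesis using nd by (simp add: root_char_def)
qed

lemma dirichlet_char_root_char:
  assumes z: "z ^ order_units = 1"
  shows "dirichlet_char Q (root_char z)"
  unfolding dirichlet_char_def
proof (intro conjI allI)
  fix A B
  show "root_char z (A + B * Q) = root_char z A"
  proof -
    have "Q dvd A + B * Q \<longleftrightarrow> Q dvd A"
      by (metis dvd_triv_right dvd_add_left_iff)
    moreover have "dlog (A + B * Q) = dlog A" by (simp add: dlog_def)
    ultimately show ?thesis by (simp add: root_char_def)
  qed
  show "root_char z (A * B) = root_char z A * root_char z B"
  proof (cases "Q dvd A \<or> Q dvd B")
    case True
    then show ?thesis by (auto simp: root_char_def)
  next
    case False
    then have "(A * B) mod Q = g ^ (dlog A + dlog B) mod Q"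
      using dlog[of A] dlog[of B] mod_mult_cong[of "g ^ dlog A" Q A "g ^ dlog B" B]
      by (simp add: power_add)
    from root_char_eq_power[OF z this] False show ?thesis
      by (simp add: root_char_def power_add)
  qed
  show "root_char z A \<noteq> 0 \<longleftrightarrow> coprime A Q"
  proof -
    have "z \<noteq> 0" using z order_units_pos by (auto simp: power_0_left)
    then show ?thesis by (simp add: root_char_def irreducible_coprime_iff[OF irreducible])
  qed
qed

lemma root_char_1: "root_char 1 = trivial_char Q"
  by (auto simp: root_char_def trivial_char_def irreducible_coprime_iff[OF irreducible])

text \<open>The inverse map is evaluation at g: a character is determined by its value there, and
  that value is a root of unity because g^order_units is congruent to 1. Sums over characters
  thereby become sums over complex roots of unity.\<close>

lemma bij_betw_root_char:
  "bij_betw root_char {z. z ^ order_units = 1} {chi. dirichlet_char Q chi}"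
proof (rule bij_betwI')
  fix z w :: complex assume z: "z \<in> {z. z ^ order_units = 1}" and w: "w \<in> {z. z ^ order_units = 1}"
  have at_root: "root_char u g = u" if "u \<in> {z. z ^ order_units = 1}" for u
    using root_char_eq_power[of u g 1] that by simp
  show "root_char z = root_char w \<longleftrightarrow> z = w"
  proof
    assume "root_char z = root_char w"
    then have "root_char z g = root_char w g" by (rule fun_cong)
    then show "z = w" unfolding at_root[OF z] at_root[OF w] .
  qed simp
next
  fix chi assume "chi \<in> {chi. dirichlet_char Q chi}"
  then have chi: "dirichlet_char Q chi" by simp
  then have mult: "chi (A * B) = chi A * chi B" for A B
    unfolding dirichlet_char_def by blast
  have "chi 1 \<noteq> 0" using chi coprime_1_left unfolding dirichlet_char_def by blast
  then have one: "chi 1 = 1" using mult[of 1 1] by simp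
  have pow: "chi (g ^ i) = chi g ^ i" for i
    by (induction i) (simp_all add: one mult)
  have "g ^ order_units mod Q = 1 mod Q"
    by (simp add: root_power_eq_1_iff order_units_def)
  then have z: "chi g ^ order_units = 1"
    using dirichlet_char_mod[OF chi] pow one by metis
  have "chi A = root_char (chi g) A" for A
  proof (cases "Q dvd A")
    case True
    then have "chi A = 0"
      using chi irreducible_coprime_iff[OF irreducible, of A] unfolding dirichlet_char_def by blast
    then show ?thesis using True by (simp add: root_char_def)
  next
    case False
    then have "chi A = chi (g ^ dlog A)"
      using dirichlet_char_mod[OF chi] dlog by metis
    then show ?thesis using False pow by (simp add: root_char_def)
  qed
  then show "\<exists>z\<in>{z. z ^ order_units = 1}. chi = root_char z" using z by blast
qed (simp add: dirichlet_char_root_char)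

lemma root_char_orthogonality:
  assumes "\<not> Q dvd A" "\<not> Q dvd B"
  shows "(\<Sum>z | z ^ order_units = 1. root_char z A * cnj (root_char z B)) =
           (if A mod Q = B mod Q then of_nat order_units else 0)"
proof -
  have "A mod Q = B mod Q \<longleftrightarrow> dlog A mod order_units = dlog B mod order_units"
    using assms dlog root_power_eq_iff by metis
  then show ?thesis
    using assms roots_unity_orthogonality[OF order_units_pos, of "dlog A" "dlog B"]
    by (simp add: root_char_def)
qed
section \<open>Moments of the central values\<close>

definition small_monic :: "'a poly set" where
  "small_monic = (\<Union>m<degree Q. monic_polys_deg m)"

text \<open>This is |N|^(-1/2).\<close>

definition weight :: "'a poly \<Rightarrow> real" where
  "weight N = real CARD('a) powr - (real (degree N) / 2)"

definition central_value :: "complex \<Rightarrow> complex" where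
  "central_value z = (\<Sum>N\<in>small_monic. of_real (weight N) * root_char z N)"

lemma sum_small_monic:
  "(\<Sum>N\<in>small_monic. f N) = (\<Sum>m<degree Q. \<Sum>N\<in>monic_polys_deg m. f N)"
  unfolding small_monic_def
  by (rule sum.UNION_disjoint) (auto simp: finite_monic_polys_deg, auto simp: monic_polys_deg_def)

lemma finite_small_monic: "finite small_monic"
  by (simp add: small_monic_def finite_monic_polys_deg)

lemma small_monic_mod: "N \<in> small_monic \<Longrightarrow> N mod Q = N"
  by (auto simp: small_monic_def monic_polys_deg_def mod_poly_less)

lemma small_monic_not_dvd:
  assumes "N \<in> small_monic"
  shows "\<not> Q dvd N"
proof
  assume "Q dvd N"
  then have "N = 0" using small_monic_mod[OF assms] by (simp add: dvd_eq_mod_eq_0)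
  then show False using assms by (auto simp: small_monic_def monic_polys_deg_def)
qed

lemma one_in_small_monic: "1 \<in> small_monic"
  using degree_pos by (auto simp: small_monic_def monic_polys_deg_def)

text \<open>The point 1/2 falls in the polynomial branch of \<open>dirichlet_L\<close>. This
  includes z = 1, where the value is merely the truncated sum for the trivial character;
  \<open>central_value_1\<close> computes it so that it can be subtracted.\<close>

lemma dirichlet_L_half_root_char: "dirichlet_L Q (1/2) (root_char z) = central_value z"
proof -
  have powr: "of_nat CARD('a) powr (- (of_nat m * (1/2))) = complex_of_real (real CARD('a) powr - (real m / 2))"
    for m
    using powr_of_real[of "real CARD('a)" "- (real m / 2)"] by simp
  have "dirichlet_L Q (1/2) (root_char z) =
      (\<Sum>m<degree Q. of_nat CARD('a) powr (- (of_nat m * (1/2))) * (\<Sum>N\<in>monic_polys_deg m. root_char z N))"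
    by (simp add: dirichlet_L_def)
  also have "\<dots> = (\<Sum>m<degree Q. \<Sum>N\<in>monic_polys_deg m. of_real (weight N) * root_char z N)"
  proof (rule sum.cong[OF refl])
    fix m
    show "of_nat CARD('a) powr (- (of_nat m * (1/2))) * (\<Sum>N\<in>monic_polys_deg m. root_char z N) =
        (\<Sum>N\<in>monic_polys_deg m. of_real (weight N) * root_char z N)"
      unfolding powr sum_distrib_left
      by (rule sum.cong) (auto simp: weight_def monic_polys_deg_def)
  qed
  finally show ?thesis by (simp add: central_value_def sum_small_monic)
qed

lemma root_char_at_1: "z ^ order_units = 1 \<Longrightarrow> root_char z 1 = 1"
  using root_char_eq_power[of z 1 0] by simp

text \<open>Inserting the conjugate of the character value at 1, which is 1, brings the sum into the
  shape of orthogonality. Elements of \<open>small_monic\<close> are reduced modulo Q, so being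
  congruent to 1 means being equal to 1, and only the term of weight 1 survives.\<close>

lemma sum_central_value: "(\<Sum>z | z ^ order_units = 1. central_value z) = of_nat order_units"
proof -
  let ?U = "{z::complex. z ^ order_units = 1}"
  have nd1: "\<not> Q dvd 1" by (rule small_monic_not_dvd[OF one_in_small_monic])
  have "(\<Sum>z\<in>?U. central_value z) =
      (\<Sum>N\<in>small_monic. of_real (weight N) * (\<Sum>z\<in>?U. root_char z N * cnj (root_char z 1)))"
    unfolding central_value_def sum_distrib_left
    by (subst sum.swap) (auto intro!: sum.cong simp: root_char_at_1)
  also have "\<dots> = (\<Sum>N\<in>small_monic. if N = 1 then of_nat order_units else 0)"
  proof (rule sum.cong[OF refl])
    fix N assume N: "N \<in> small_monic"
    show "of_real (weight N) * (\<Sum>z\<in>?U. root_char z N * cnj (root_char z 1)) =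
        (if N = 1 then of_nat order_units else 0)"
      unfolding root_char_orthogonality[OF small_monic_not_dvd[OF N] nd1]
        small_monic_mod[OF N] small_monic_mod[OF one_in_small_monic]
      by (simp add: weight_def)
  qed
  also have "\<dots> = of_nat order_units"
    using finite_small_monic one_in_small_monic by simp
  finally show ?thesis .
qed

lemma weight_squared: "weight N ^ 2 * real CARD('a) ^ degree N = 1"
proof -
  have "weight N ^ 2 = real CARD('a) powr - real (degree N)"
    by (simp add: weight_def power2_eq_square flip: powr_add)
  then show ?thesis by (simp add: powr_minus powr_realpow)
qed

lemma sum_central_value_squared:
  "(\<Sum>z | z ^ order_units = 1. norm (central_value z) ^ 2) = real (order_units * degree Q)"
proof -
  let ?U = "{z::complex. z ^ order_units = 1}"
  \<comment> \<open>Passing to complex numbers allows |L|^2 to be expanded as L times its conjugate;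
    orthogonality then leaves only the diagonal.\<close>
  have "complex_of_real (\<Sum>z\<in>?U. norm (central_value z) ^ 2) =
      (\<Sum>z\<in>?U. \<Sum>M\<in>small_monic. \<Sum>N\<in>small_monic.
         of_real (weight M * weight N) * (root_char z M * cnj (root_char z N)))"
    unfolding of_real_sum complex_norm_square central_value_def
    by (simp add: sum_product mult_ac)
  also have "\<dots> = (\<Sum>M\<in>small_monic. \<Sum>N\<in>small_monic.
         of_real (weight M * weight N) * (\<Sum>z\<in>?U. root_char z M * cnj (root_char z N)))"
    unfolding sum_distrib_left
    by (subst sum.swap, rule sum.cong[OF refl], rule sum.swap)
  also have "\<dots> = (\<Sum>M\<in>small_monic. \<Sum>N\<in>small_monic.
         if M = N then of_real (weight M * weight N * real order_units) else 0)"
  proof (intro sum.cong refl)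
    fix M N assume *: "M \<in> small_monic" "N \<in> small_monic"
    show "of_real (weight M * weight N) * (\<Sum>z\<in>?U. root_char z M * cnj (root_char z N)) =
        (if M = N then of_real (weight M * weight N * real order_units) else (0::complex))"
      unfolding root_char_orthogonality[OF *[THEN small_monic_not_dvd]] *[THEN small_monic_mod]
      by simp
  qed
  also have "\<dots> = of_real (\<Sum>N\<in>small_monic. weight N ^ 2 * real order_units)"
    using finite_small_monic by (simp add: power2_eq_square)
  finally have "(\<Sum>z\<in>?U. norm (central_value z) ^ 2) =
      (\<Sum>N\<in>small_monic. weight N ^ 2 * real order_units)"
    by (simp only: of_real_eq_iff)
  \<comment> \<open>In each degree m there are q^m monic polynomials of squared weight q^(-m), so
    every degree contributes the same amount.\<close>
  also have "\<dots> = (\<Sum>m<degree Q. real order_units)"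
    unfolding sum_small_monic
  proof (rule sum.cong[OF refl])
    fix m
    define S where "S = (monic_polys_deg m :: 'a poly set)"
    have "(\<Sum>N\<in>S. weight N ^ 2 * real order_units) =
        (\<Sum>N\<in>S. real order_units / real CARD('a) ^ m)"
    proof (rule sum.cong[OF refl])
      fix N assume "N \<in> S"
      then have "degree N = m" by (simp add: S_def monic_polys_deg_def)
      then show "weight N ^ 2 * real order_units = real order_units / real CARD('a) ^ m"
        using weight_squared[of N] by (simp add: field_simps)
    qed
    also have "\<dots> = real order_units" by (simp add: S_def card_monic_polys_deg)
    finally show "(\<Sum>N\<in>monic_polys_deg m. weight N ^ 2 * real order_units) = real order_units"
      by (simp add: S_def)
  qed
  finally show ?thesis by (simp add: mult.commute)
qed

lemma central_value_1:
  "central_value 1 = of_real (\<Sum>m<degree Q. sqrt (real CARD('a)) ^ m)"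
proof -
  define q where "q = real CARD('a)"
  have q: "q > 0" by (simp add: q_def)
  have "(\<Sum>N\<in>monic_polys_deg m. weight N) = sqrt q ^ m" for m
  proof -
    have "(\<Sum>N\<in>monic_polys_deg m. weight N) =
        (\<Sum>N\<in>(monic_polys_deg m :: 'a poly set). q powr - (real m / 2))"
      by (rule sum.cong) (auto simp: weight_def monic_polys_deg_def q_def)
    also have "\<dots> = q ^ m * q powr - (real m / 2)"
      by (simp add: card_monic_polys_deg q_def)
    also have "\<dots> = q powr (real m / 2)"
      using q by (simp flip: powr_realpow powr_add)
    also have "\<dots> = sqrt q ^ m"
      using q by (simp add: powr_half_sqrt[symmetric] powr_powr flip: powr_realpow)
    finally show ?thesis .
  qed
  moreover have "central_value 1 = of_real (\<Sum>N\<in>small_monic. weight N)"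
    unfolding central_value_def of_real_sum
    by (rule sum.cong) (auto simp: root_char_def small_monic_not_dvd)
  ultimately show ?thesis by (simp add: sum_small_monic q_def)
qed

text \<open>With x = q^(deg Q / 2) the full first moment is x^2 - 1, while the trivial character
  contributes a geometric sum of size O(x). Explicit constants make the comparison valid down to the
  extreme case q = 2, deg Q = 2, that is x = 2.\<close>

lemma first_moment_lower_bound:
  assumes deg: "degree Q \<ge> 2"
  shows "real order_units - (\<Sum>m<degree Q. sqrt (real CARD('a)) ^ m) \<ge> real CARD('a) ^ degree Q / 8"
proof -
  define t where "t = sqrt (real CARD('a))"
  define x where "x = t ^ degree Q"
  have t2: "t ^ 2 = real CARD('a)" by (simp add: t_def)
  have "real CARD('a) \<ge> 2" using card_field_ge_2 by simp
  \<comment> \<open>7/5 is a rational lower bound for sqrt 2; it gives 1/(t - 1) \<le> 5/2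
    below.\<close>
  then have "t \<ge> 7/5" unfolding t_def by (intro real_le_rsqrt) (simp add: power2_eq_square)
  have "t ^ 2 \<le> x"
    unfolding x_def using deg \<open>t \<ge> 7/5\<close> by (intro power_increasing) auto
  then have x: "x \<ge> 2" using t2 \<open>real CARD('a) \<ge> 2\<close> by simp
  have xx: "real CARD('a) ^ degree Q = x * x"
    unfolding x_def t2[symmetric] by (simp add: power_mult_distrib[symmetric] power2_eq_square)
  have "real order_units = x * x - 1"
    using order_units_pos unfolding order_units_def xx[symmetric] by (simp add: of_nat_diff)
  moreover have "(\<Sum>m<degree Q. t ^ m) \<le> (x - 1) * (5/2)"
  proof -
    have "(\<Sum>m<degree Q. t ^ m) = (x - 1) / (t - 1)"
      using \<open>t \<ge> 7/5\<close> unfolding x_def by (intro geometric_sum) auto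
    also have "\<dots> \<le> (x - 1) / (2/5)"
      using x \<open>t \<ge> 7/5\<close> by (intro divide_left_mono) auto
    finally show ?thesis by simp
  qed
  moreover have "x * x - 1 - (x - 1) * (5/2) \<ge> x * x / 8"
  proof -
    \<comment> \<open>This product is 8 times the difference of the two sides of the claim.\<close>
    have "0 \<le> (x - 2) * (7 * x - 6)" using x by (intro mult_nonneg_nonneg) auto
    then show ?thesis by (simp add: field_simps)
  qed
  ultimately show ?thesis unfolding xx t_def[symmetric] by linarith
qed

section \<open>Counting nonvanishing central values by Cauchy-Schwarz\<close>

lemma card_nonvanishing_chars_ge:
  assumes deg: "degree Q \<ge> 2"
  shows "real (card (nonvanishing_chars Q)) \<ge> real CARD('a) ^ degree Q / (64 * real (degree Q))"
proof -
  let ?U = "{z::complex. z ^ order_units = 1}"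
  define Y where "Y = {z \<in> ?U. z \<noteq> 1 \<and> central_value z \<noteq> 0}"
  define n where "n = real order_units"
  define d where "d = real (degree Q)"
  define N where "N = real CARD('a) ^ degree Q"
  have d: "d > 0" using degree_pos by (simp add: d_def)
  have N: "N > 0" by (simp add: N_def)
  have "0 < n" using order_units_pos by (simp add: n_def)
  have "order_units \<le> CARD('a) ^ degree Q" by (simp add: order_units_def)
  then have "n \<le> N" unfolding n_def N_def by (metis of_nat_le_iff of_nat_power)
  have finU: "finite ?U" using order_units_pos by (rule finite_nth_roots)
  have inj: "inj_on root_char ?U" and im: "root_char ` ?U = {chi. dirichlet_char Q chi}"
    using bij_betw_root_char by (auto simp: bij_betw_def)
  have "nonvanishing_chars Q = root_char ` Y"
  proof -
    have "root_char z = trivial_char Q \<longleftrightarrow> z = 1" if "z \<in> ?U" for z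
      using inj_on_eq_iff[OF inj that, of 1] by (simp add: root_char_1)
    moreover have "nonvanishing_chars Q =
        {chi \<in> root_char ` ?U. chi \<noteq> trivial_char Q \<and> dirichlet_L Q (1/2) chi \<noteq> 0}"
      unfolding im nonvanishing_chars_def nontrivial_chars_def by blast
    ultimately show ?thesis by (auto simp: Y_def dirichlet_L_half_root_char)
  qed
  moreover have Y: "Y \<subseteq> ?U" by (auto simp: Y_def)
  ultimately have card: "card (nonvanishing_chars Q) = card Y"
    using card_image[OF inj_on_subset[OF inj Y]] by simp
  define s where "s = (\<Sum>m<degree Q. sqrt (real CARD('a)) ^ m)"
  \<comment> \<open>The nontrivial characters left out of \<open>Y\<close> have central value
    0.\<close>
  have "(\<Sum>z\<in>Y. central_value z) = (\<Sum>z\<in>?U - {1}. central_value z)"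
    using finU by (intro sum.mono_neutral_left) (auto simp: Y_def)
  also have "\<dots> = of_real (n - s)"
    using finU by (simp add: sum_diff1 sum_central_value central_value_1 n_def s_def)
  finally have first: "(\<Sum>z\<in>Y. central_value z) = of_real (n - s)" .
  have lower: "n - s \<ge> N / 8"
    using first_moment_lower_bound[OF deg] by (simp add: n_def s_def N_def)
  then have "(N / 8) ^ 2 \<le> (n - s) ^ 2" using N by (intro power_mono) auto
  also have "n - s = norm (\<Sum>z\<in>Y. central_value z)"
    unfolding first norm_of_real using lower N by simp
  also have "\<dots> ^ 2 \<le> (\<Sum>z\<in>Y. 1 * norm (central_value z)) ^ 2"
    by (intro power_mono) (auto intro: norm_sum)
  also have "\<dots> \<le> (\<Sum>z\<in>Y. 1 ^ 2) * (\<Sum>z\<in>Y. norm (central_value z) ^ 2)"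
    by (rule Cauchy_Schwarz_ineq_sum)
  \<comment> \<open>Enlarging the second moment to all characters, the trivial one included, adds
    only nonnegative terms and makes the exact formula available.\<close>
  also have "\<dots> \<le> real (card Y) * (\<Sum>z\<in>?U. norm (central_value z) ^ 2)"
    using finU by (auto intro!: mult_left_mono sum_mono2 simp: Y_def)
  also have "\<dots> = real (card Y) * (n * d)"
    by (simp add: sum_central_value_squared n_def d_def)
  also have "\<dots> \<le> real (card Y) * (N * d)"
    using \<open>0 < n\<close> \<open>n \<le> N\<close> d by (intro mult_left_mono mult_right_mono) auto
  \<comment> \<open>The constant 64 is the square of the 8 lost in the first moment; bounding n by N
    lets one factor N cancel.\<close>
  finally have "N * N \<le> N * (64 * d * real (card Y))" by (simp add: power2_eq_square field_simps)
  then have "N \<le> 64 * d * real (card Y)" using N by (rule mult_left_le_imp_le)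
  then show ?thesis using d by (simp add: card N_def[symmetric] d_def[symmetric] field_simps)
qed

lemma card_nontrivial_chars_le:
  "card (nontrivial_chars Q) \<le> CARD('a) ^ degree Q" "finite (nontrivial_chars Q)"
proof -
  have fin: "finite {z::complex. z ^ order_units = 1}" using order_units_pos by (rule finite_nth_roots)
  have *: "finite {chi. dirichlet_char Q chi}" "card {chi. dirichlet_char Q chi} = order_units"
    using bij_betw_finite[OF bij_betw_root_char] bij_betw_same_card[OF bij_betw_root_char]
      fin card_roots_unity_eq[OF order_units_pos] by auto
  have sub: "nontrivial_chars Q \<subseteq> {chi. dirichlet_char Q chi}"
    by (auto simp: nontrivial_chars_def)
  show "finite (nontrivial_chars Q)" by (rule finite_subset[OF sub *(1)])
  have "card (nontrivial_chars Q) \<le> order_units" using card_mono[OF *(1) sub] *(2) by simp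
  then show "card (nontrivial_chars Q) \<le> CARD('a) ^ degree Q" by (simp add: order_units_def)
qed

end

section \<open>Explicit bounds for the number and the proportion, and uniform constants\<close>

lemma nonvanishing_bounds:
  fixes Q :: "'a::{field,finite} poly"
  assumes irr: "irreducible Q" and deg: "degree Q \<ge> 2"
  shows "real (card (nonvanishing_chars Q)) \<ge> real CARD('a) ^ degree Q / (64 * real (degree Q))"
    and "real (card (nonvanishing_chars Q)) / real (card (nontrivial_chars Q))
           \<ge> 1 / (64 * real (degree Q))"
proof -
  obtain g where "primitive_root_poly Q g"
    using exists_primitive_root_poly[OF irr] irr unfolding primitive_root_poly_def by metis
  then interpret primitive_root_poly Q g .
  define q where "q = real CARD('a) ^ degree Q"
  define d where "d = real (degree Q)"
  define X where "X = real (card (nonvanishing_chars Q))"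
  define T where "T = real (card (nontrivial_chars Q))"
  have q: "q > 0" and d: "d > 0" using deg by (simp_all add: q_def d_def)
  show X: "real (card (nonvanishing_chars Q)) \<ge> real CARD('a) ^ degree Q / (64 * real (degree Q))"
    by (rule card_nonvanishing_chars_ge[OF deg])
  then have X': "X \<ge> q / (64 * d)" by (simp add: X_def q_def d_def)
  moreover have "q / (64 * d) > 0" using q d by simp
  moreover have "X \<le> T" unfolding X_def T_def
    using card_nontrivial_chars_le(2) by (auto intro!: card_mono simp: nonvanishing_chars_def)
  \<comment> \<open>Positivity of the denominator matters, since division by zero would make the
    proportion 0. It follows from 0 < X \<le> T.\<close>
  ultimately have T: "T > 0" by linarith
  have "T \<le> q" using card_nontrivial_chars_le(1) unfolding T_def q_def
    by (metis of_nat_le_iff of_nat_power)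
  have "1 / (64 * d) = (q / (64 * d)) / q" using q by simp
  also have "\<dots> \<le> X / T"
    using X' T \<open>T \<le> q\<close> q d by (intro frac_le) (auto simp: X_def)
  finally show "real (card (nonvanishing_chars Q)) / real (card (nontrivial_chars Q))
           \<ge> 1 / (64 * real (degree Q))"
    by (simp add: X_def T_def d_def)
qed

theorem corollary4p3:
  shows "(\<exists>c>0. \<forall>Q :: 'a::{field,finite} poly. irreducible Q \<and> degree Q \<ge> 2 \<longrightarrow>
            (let D = degree Q - 1 in
              real (card (nonvanishing_chars Q)) \<ge> c * (real CARD('a) ^ D / real D)))
       \<and> (\<exists>c>0. \<forall>Q :: 'a::{field,finite} poly. irreducible Q \<and> degree Q \<ge> 2 \<longrightarrow>
            (let D = degree Q - 1 in
              real (card (nonvanishing_chars Q)) / real (card (nontrivial_chars Q))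
                \<ge> c * (1 / real D)))"
proof -
  \<comment> \<open>Passing from deg Q to D = deg Q - 1 costs a factor 2, because deg Q \<le> 2 * D
    when deg Q is at least 2. This turns 64 into 128.\<close>
  have bound: "1 / 128 * (1 / real (degree Q - 1)) \<le> 1 / (64 * real (degree Q))"
    if "degree Q \<ge> 2" for Q :: "'a poly"
    using that by (simp add: divide_simps of_nat_diff)
  have first: "1 / 128 * (real CARD('a) ^ (degree Q - 1) / real (degree Q - 1))
      \<le> real (card (nonvanishing_chars Q))"
    if "irreducible Q" "degree Q \<ge> 2" for Q :: "'a poly"
  proof -
    have "1 / 128 * (real CARD('a) ^ (degree Q - 1) / real (degree Q - 1)) =
        real CARD('a) ^ (degree Q - 1) * (1 / 128 * (1 / real (degree Q - 1)))" by simp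
    \<comment> \<open>A factor q is given away here by q^D \<le> q^(deg Q), so the resulting
      constant does not depend on q.\<close>
    also have "\<dots> \<le> real CARD('a) ^ degree Q * (1 / (64 * real (degree Q)))"
      using bound[OF that(2)]
      by (intro mult_mono power_increasing) auto
    also have "\<dots> \<le> real (card (nonvanishing_chars Q))"
      using nonvanishing_bounds(1)[OF that] by simp
    finally show ?thesis .
  qed
  have second: "1 / 128 * (1 / real (degree Q - 1))
      \<le> real (card (nonvanishing_chars Q)) / real (card (nontrivial_chars Q))"
    if "irreducible Q" "degree Q \<ge> 2" for Q :: "'a poly"
    using bound[OF that(2)] nonvanishing_bounds(2)[OF that] by (rule order_trans)
  show ?thesis
    unfolding Let_def
    by (intro conjI exI[of _ "1 / 128"] allI impI) (use first second in auto)
qed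

end
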